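(* Let $N\ge1$, let $\alpha_1,\dots,\alpha_N$ be rationally independent real numbers (linearly independent over $\mathbb{Q}$), and let $p_0\ge0$, $0<p_i<1$ for $i\in\{1,\dots,N\}$, with $\sum_{i=0}^Np_i=1$. Let $x_n=\sum_{j=1}^nu_j$, $x_0=0$, where $(u_j)_{j\ge1}$ are i.i.d. real random variables with law $$p_0\delta_0+\frac12\sum_{i=1}^Np_i(\delta_{\alpha_i}+\delta_{-\alpha_i}),$$ and let $r_n=\mathbb{P}[x_n=0]$. Set $C(p):=\prod_{i=1}^N\frac{1}{\sqrt{2\pi p_i}}$. Then, as $n\to+\infty$: - If $p_0>0$, then $r_n\sim_n\dfrac{C(p)}{n^{N/2}}$. - If $p_0=0$, then $r_n=0$ if $n$ is odd, and for $n$ even $r_n\sim_n\dfrac{2C(p)}{n^{N/2}}$.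
   Context: $\delta_x$ denotes the Dirac mass at $x$. The symbol $\sim_n$ means that the ratio tends to $1$ as $n\to\infty$ (along even $n$ in the second case). *)

theory Defs
  imports "HOL-Probability.Probability"
begin

text \<open>The family of the \<open>\<alpha> i\<close>, rather than only the set of its values, is required to be
  independent; hence the injectivity clause.\<close>

definition rationally_independent :: "nat set \<Rightarrow> (nat \<Rightarrow> real) \<Rightarrow> bool" where
  "rationally_independent I \<alpha> \<longleftrightarrow>
     inj_on \<alpha> I \<and> module.independent (\<lambda>(q::rat) (x::real). of_rat q * x) (\<alpha> ` I)"

text \<open>\<open>return borel a\<close> is the Dirac mass at \<open>a\<close>. The lemma below shows that \<open>measure_of\<close> is
  applied here to an actual measure on the Borel sets, so that it does not default to zero.\<close>

definition step_law :: "nat \<Rightarrow> (nat \<Rightarrow> real) \<Rightarrow> (nat \<Rightarrow> real) \<Rightarrow> real measure" where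
  "step_law N \<alpha> p = measure_of UNIV (sets borel)
     (\<lambda>A. ennreal (p 0) * emeasure (return borel 0) A
        + ennreal (1 / 2) * (\<Sum>i=1..N. ennreal (p i) *
            (emeasure (return borel (\<alpha> i)) A + emeasure (return borel (- \<alpha> i)) A)))"

lemma emeasure_step_law:
  assumes "A \<in> sets borel"
  shows "emeasure (step_law N \<alpha> p) A =
     ennreal (p 0) * emeasure (return borel 0) A
        + ennreal (1 / 2) * (\<Sum>i=1..N. ennreal (p i) *
            (emeasure (return borel (\<alpha> i)) A + emeasure (return borel (- \<alpha> i)) A))"
    (is "_ = ?f A")
proof (rule emeasure_measure_of[OF step_law_def])
  show "positive (sets (step_law N \<alpha> p)) ?f"
    by (simp add: positive_def)
  have sets_eq: "sets (step_law N \<alpha> p) = sets (borel :: real measure)"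
    unfolding step_law_def using sets.sets_measure_of_eq[of "borel :: real measure"] by simp
  show "A \<in> sets (step_law N \<alpha> p)"
    using assms sets_eq by simp
  show "countably_additive (sets (step_law N \<alpha> p)) ?f"
    unfolding sets_eq
  proof (rule countably_additiveI)
    fix B :: "nat \<Rightarrow> real set"
    assume B: "range B \<subseteq> sets borel" "disjoint_family B"
    have D: "(\<Sum>n. emeasure (return borel a) (B n)) = emeasure (return borel a) (\<Union>n. B n)"
      for a :: real
      using B by (intro suminf_emeasure) auto
    have E: "(\<lambda>n. emeasure (return borel a) (B n)) sums emeasure (return borel a) (\<Union>n. B n)"
      for a :: real
      using summable_sums[OF summableI, of "\<lambda>n. emeasure (return borel a) (B n)"] unfolding D .
    have cmult: "(\<lambda>n. c * f n) sums (c * s)" if "f sums s" for c s :: ennreal and f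
      using summable_sums[OF summableI, of "\<lambda>n. c * f n"] sums_unique[OF that]
      unfolding ennreal_suminf_cmult by simp
    have term_sums: "(\<lambda>n. ennreal (p i) *
          (emeasure (return borel (\<alpha> i)) (B n) + emeasure (return borel (- \<alpha> i)) (B n)))
        sums (ennreal (p i) * (emeasure (return borel (\<alpha> i)) (\<Union>n. B n)
          + emeasure (return borel (- \<alpha> i)) (\<Union>n. B n)))" for i
      by (rule cmult[OF sums_add[OF E E]])
    show "(\<Sum>n. ?f (B n)) = ?f (\<Union>n. B n)"
      by (rule sums_unique[symmetric],
          rule sums_add[OF cmult[OF E] cmult[OF sums_sum[OF term_sums]]])
  qed
qed simp

definition walk :: "(nat \<Rightarrow> 'a \<Rightarrow> real) \<Rightarrow> nat \<Rightarrow> 'a \<Rightarrow> real" where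
  "walk u n \<omega> = (\<Sum>j=1..n. u j \<omega>)"

definition return_prob :: "'a measure \<Rightarrow> (nat \<Rightarrow> 'a \<Rightarrow> real) \<Rightarrow> nat \<Rightarrow> real" where
  "return_prob M u n = measure M {\<omega> \<in> space M. walk u n \<omega> = 0}"

definition C_const :: "nat \<Rightarrow> (nat \<Rightarrow> real) \<Rightarrow> real" where
  "C_const N p = (\<Prod>i=1..N. 1 / sqrt (2 * pi * p i))"

end

theory Submission
  imports Defs "HOL-Real_Asymp.Real_Asymp"
begin

text \<open>Rational independence makes the position \<open>\<Sum>i=1..N. k i * \<alpha> i\<close> determine the integers \<open>k i\<close>, so
  the walk is a nearest-neighbour walk on the integer lattice of dimension \<open>N\<close>, with characteristic
  function \<open>\<phi>(t) = p 0 + (\<Sum>i=1..N. p i * cos (t i))\<close>. Fourier inversion (\<open>fourier_inversion\<close>), proved by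
  comparing two recursions in time, gives for every scale \<open>L > 0\<close>
  that \<open>(2 * pi * L) ^ N * r\<^sub>n\<close> is the integral of \<open>\<phi>(s / L) ^ n\<close> over the cube
  \<open>[- pi * L, pi * L] ^ N\<close>. The choice \<open>L = sqrt n\<close> produces the factor \<open>n powr (N / 2)\<close>.

  The integral is split into the contributions \<open>A(n)\<close> of the positive part and \<open>B(n)\<close> of the negative
  part of \<open>\<phi>\<close>, so that it equals \<open>A(n) + (- 1) ^ n * B(n)\<close>. On the positive part there is a Gaussian
  bound on the whole cube, and dominated convergence (\<open>positive_part_integral_limit\<close>) shows that \<open>A\<close>
  tends to the integral of \<open>exp (- (\<Sum>i=1..N. p i * (s i)\<^sup>2 / 2))\<close>, which is \<open>(2 * pi) ^ N * C(p)\<close>.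

  If \<open>p 0 > 0\<close>, then \<open>\<phi> \<ge> 2 * p 0 - 1 > - 1\<close> and \<open>B\<close> is exponentially small. If \<open>p 0 = 0\<close>, then
  \<open>\<phi>\<close> has a second peak at \<open>(pi, \<dots>, pi)\<close>, of value \<open>- 1\<close>. Its contribution is found without a second
  expansion. By parity \<open>r\<^sub>n = 0\<close> for odd \<open>n\<close>, which says that the two parts have
  equal odd moments. Moments of numbers in \<open>[0, 1]\<close> decrease with the exponent, so for even \<open>n\<close> and on
  the same cube \<open>B\<close> at exponent \<open>n\<close> lies between \<open>A\<close> at the exponents \<open>n + 1\<close> and \<open>n - 1\<close>. Hence \<open>B\<close>
  has the same limit as \<open>A\<close>, and this is the factor \<open>2\<close>.\<close>

section \<open>Transition probabilities of the walk\<close>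

lemma rationally_independent_int_combination:
  assumes "rationally_independent {1..N} \<alpha>"
    and "(\<Sum>i=1..N. of_int (k i) * \<alpha> i) = 0" and "i \<in> {1..N}"
  shows "k i = (0::int)"
proof -
  interpret Q: vector_space "\<lambda>(q::rat) (x::real). of_rat q * x"
    by standard (auto simp: algebra_simps of_rat_add of_rat_mult)
  have inj: "inj_on \<alpha> {1..N}" and ind: "Q.independent (\<alpha> ` {1..N})"
    using assms(1) by (auto simp: rationally_independent_def)
  define c :: "real \<Rightarrow> rat" where "c v = of_int (k (the_inv_into {1..N} \<alpha> v))" for v
  have c: "c (\<alpha> j) = of_int (k j)" if "j \<in> {1..N}" for j
    using that inj by (simp add: c_def the_inv_into_f_f)
  have "(\<Sum>v\<in>\<alpha> ` {1..N}. of_rat (c v) * v) = (\<Sum>j=1..N. of_rat (c (\<alpha> j)) * \<alpha> j)"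
    by (rule sum.reindex_cong[OF inj]) auto
  also have "\<dots> = 0"
    using assms(2) by (simp add: c)
  finally have "c (\<alpha> i) = 0"
    using ind assms(3) unfolding Q.independent_explicit_module by blast
  then show ?thesis using c[OF assms(3)] by simp
qed

lemma measure_step_law:
  assumes "\<And>i. i \<in> {0..N} \<Longrightarrow> 0 \<le> p i" and "A \<in> sets borel"
  shows "measure (step_law N \<alpha> p) A =
    p 0 * indicator A 0 + 1 / 2 * (\<Sum>i=1..N. p i * (indicator A (\<alpha> i) + indicator A (- \<alpha> i)))"
proof -
  have *: "ennreal (p 0) * indicator A 0 = ennreal (p 0 * indicator A 0)"
    by (auto split: split_indicator)
  have **: "(\<Sum>i=1..N. ennreal (p i) * (indicator A (\<alpha> i) + indicator A (- \<alpha> i))) =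
    ennreal (\<Sum>i=1..N. p i * (indicator A (\<alpha> i) + indicator A (- \<alpha> i)))"
    using assms(1)
    by (subst sum_ennreal[symmetric])
       (auto intro!: sum.cong mult_nonneg_nonneg simp: ennreal_mult' ennreal_plus ennreal_indicator)
  have nn: "0 \<le> (\<Sum>i=1..N. p i * (indicator A (\<alpha> i) + indicator A (- \<alpha> i)))"
    using assms(1) by (intro sum_nonneg mult_nonneg_nonneg) auto
  have "emeasure (step_law N \<alpha> p) A = ennreal (p 0 * indicator A 0) +
      ennreal (1/2) * ennreal (\<Sum>i=1..N. p i * (indicator A (\<alpha> i) + indicator A (- \<alpha> i)))"
    by (simp only: emeasure_step_law[OF assms(2)] emeasure_return[OF assms(2)] * **)
  also have "\<dots> = ennreal (p 0 * indicator A 0 +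
      1/2 * (\<Sum>i=1..N. p i * (indicator A (\<alpha> i) + indicator A (- \<alpha> i))))"
    using nn assms(1) by (subst ennreal_mult'[symmetric], simp, subst ennreal_plus) auto
  finally have "emeasure (step_law N \<alpha> p) A = ennreal (p 0 * indicator A 0 +
      1/2 * (\<Sum>i=1..N. p i * (indicator A (\<alpha> i) + indicator A (- \<alpha> i))))" .
  moreover have "0 \<le> p 0 * indicator A 0 +
      1/2 * (\<Sum>i=1..N. p i * (indicator A (\<alpha> i) + indicator A (- \<alpha> i)))"
    using nn assms(1) by (intro add_nonneg_nonneg mult_nonneg_nonneg) auto
  ultimately show ?thesis
    by (simp only: measure_def enn2real_ennreal)
qed

text \<open>Some points of \<open>S\<close> may carry no mass: \<open>S\<close> will consist of \<open>0\<close> and all \<open>\<plusminus> \<alpha> i\<close>, and \<open>0\<close> is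
  charged only if \<open>p 0 > 0\<close>.\<close>

lemma (in prob_space) prob_sum_of_discrete:
  fixes X Y :: "'a \<Rightarrow> real"
  assumes indep: "indep_var borel Y borel X" and "finite S"
    and supp: "prob (Y -` (- S) \<inter> space M) = 0"
  shows "prob {\<omega>\<in>space M. X \<omega> + Y \<omega> = x} =
    (\<Sum>y\<in>S. prob (Y -` {y} \<inter> space M) * prob {\<omega>\<in>space M. X \<omega> = x - y})"
proof -
  have [measurable]: "random_variable borel Y" "random_variable borel X"
    using indep_var_rv1[OF indep] indep_var_rv2[OF indep] by auto
  have S: "S \<in> sets borel" using \<open>finite S\<close> by (simp add: finite_imp_closed borel_closed)
  define E where "E y = {\<omega>\<in>space M. Y \<omega> = y \<and> X \<omega> = x - y}" for y
  have [measurable]: "E y \<in> events" for y unfolding E_def by measurable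
  have "AE \<omega> in M. Y \<omega> \<in> S"
  proof (rule AE_I)
    show "{\<omega>\<in>space M. Y \<omega> \<notin> S} \<subseteq> Y -` (- S) \<inter> space M" by auto
    show "emeasure M (Y -` (- S) \<inter> space M) = 0" using supp by (simp add: emeasure_eq_measure)
    show "Y -` (- S) \<inter> space M \<in> events"
      using S by (intro measurable_sets[of Y M borel]) auto
  qed
  then have "prob {\<omega>\<in>space M. X \<omega> + Y \<omega> = x} = prob (\<Union>y\<in>S. E y)"
    using \<open>finite S\<close> by (intro finite_measure_eq_AE) (auto simp: E_def elim!: eventually_mono)
  also have "\<dots> = (\<Sum>y\<in>S. prob (E y))"
    using \<open>finite S\<close> by (intro finite_measure_finite_Union) (auto simp: disjoint_family_on_def E_def)
  also have "\<dots> = (\<Sum>y\<in>S. prob (Y -` {y} \<inter> space M) * prob {\<omega>\<in>space M. X \<omega> = x - y})"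
  proof (rule sum.cong)
    fix y
    have "E y = (\<lambda>\<omega>. (Y \<omega>, X \<omega>)) -` ({y} \<times> {x - y}) \<inter> space M" by (auto simp: E_def)
    moreover have "X -` {x - y} \<inter> space M = {\<omega>\<in>space M. X \<omega> = x - y}" by auto
    ultimately show "prob (E y) = prob (Y -` {y} \<inter> space M) * prob {\<omega>\<in>space M. X \<omega> = x - y}"
      using indep_varD[OF indep, of "{y}" "{x - y}"] by simp
  qed simp
  finally show ?thesis .
qed

lemma (in prob_space) walk_one_step:
  assumes nonneg: "\<And>i. i \<in> {0..N} \<Longrightarrow> 0 \<le> p i"
    and indep: "indep_vars (\<lambda>_. borel) u {1..}"
    and law: "\<And>j. j \<ge> 1 \<Longrightarrow> distr M borel (u j) = step_law N \<alpha> p"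
  shows "prob {\<omega>\<in>space M. walk u (Suc n) \<omega> = x} =
    p 0 * prob {\<omega>\<in>space M. walk u n \<omega> = x} + 1 / 2 * (\<Sum>i=1..N. p i *
      (prob {\<omega>\<in>space M. walk u n \<omega> = x - \<alpha> i} + prob {\<omega>\<in>space M. walk u n \<omega> = x + \<alpha> i}))"
proof -
  \<comment> \<open>A point of \<open>S\<close> at which several of the values \<open>0\<close> and \<open>\<plusminus> \<alpha> i\<close> coincide collects the weight of
    each of them through the indicators.\<close>
  define S where "S = insert 0 (\<alpha> ` {1..N} \<union> (\<lambda>i. - \<alpha> i) ` {1..N})"
  define g where "g y = prob {\<omega>\<in>space M. walk u n \<omega> = x - y}" for y
  have S: "finite S" "S \<in> sets borel" by (auto simp: S_def finite_imp_closed borel_closed)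
  have *: "random_variable borel (u (Suc n))"
    using indep by (auto simp: indep_vars_def)
  have prob_u: "prob (u (Suc n) -` A \<inter> space M) = p 0 * indicator A 0 +
      1 / 2 * (\<Sum>i=1..N. p i * (indicator A (\<alpha> i) + indicator A (- \<alpha> i)))"
    if "A \<in> sets borel" for A
  proof -
    have "prob (u (Suc n) -` A \<inter> space M) = measure (step_law N \<alpha> p) A"
      using law[of "Suc n"] measure_distr[of "u (Suc n)" M borel A] that * by auto
    also have "\<dots> = p 0 * indicator A 0 +
        1 / 2 * (\<Sum>i=1..N. p i * (indicator A (\<alpha> i) + indicator A (- \<alpha> i)))"
      by (rule measure_step_law[OF nonneg that])
    finally show ?thesis .
  qed
  have "indep_var borel (u (Suc n)) borel (\<lambda>\<omega>. \<Sum>j=1..n. u j \<omega>)"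
    using indep_vars_subset[OF indep, of "{1..Suc n}"]
    by (intro indep_vars_sum) (auto simp: atLeastAtMostSuc_conv)
  then have ind: "indep_var borel (u (Suc n)) borel (walk u n)"
    by (simp add: walk_def[abs_def])
  have supp: "prob (u (Suc n) -` (- S) \<inter> space M) = 0"
    using S prob_u[of "- S"] by (auto simp: S_def intro!: sum.neutral)
  have delta: "(\<Sum>y\<in>S. indicator {y} z * g y) = g z" if "z \<in> S" for z
    using that S(1) by (simp add: indicator_def if_distrib[of "\<lambda>c. c * _"] sum.delta cong: if_cong)
  have inS: "0 \<in> S" "\<And>i. i \<in> {1..N} \<Longrightarrow> \<alpha> i \<in> S" "\<And>i. i \<in> {1..N} \<Longrightarrow> - \<alpha> i \<in> S"
    by (auto simp: S_def)
  have "walk u (Suc n) \<omega> = walk u n \<omega> + u (Suc n) \<omega>" for \<omega> by (simp add: walk_def)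
  then have "prob {\<omega>\<in>space M. walk u (Suc n) \<omega> = x} =
      (\<Sum>y\<in>S. prob (u (Suc n) -` {y} \<inter> space M) * g y)"
    using prob_sum_of_discrete[OF ind S(1) supp] by (simp add: g_def)
  also have "\<dots> = (\<Sum>y\<in>S. p 0 * (indicator {y} 0 * g y) +
      1 / 2 * (\<Sum>i=1..N. p i * (indicator {y} (\<alpha> i) * g y + indicator {y} (- \<alpha> i) * g y)))"
    by (simp add: prob_u algebra_simps sum_distrib_left sum_distrib_right)
  also have "\<dots> = p 0 * (\<Sum>y\<in>S. indicator {y} 0 * g y) + 1 / 2 * (\<Sum>i=1..N. p i *
      ((\<Sum>y\<in>S. indicator {y} (\<alpha> i) * g y) + (\<Sum>y\<in>S. indicator {y} (- \<alpha> i) * g y)))"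
    by (simp add: sum.distrib sum_distrib_left sum.swap[of _ S] distrib_left)
  also have "\<dots> = p 0 * g 0 + 1 / 2 * (\<Sum>i=1..N. p i * (g (\<alpha> i) + g (- \<alpha> i)))"
    using inS by (simp add: delta)
  finally show ?thesis by (simp add: g_def)
qed

text \<open>Without a lazy step every step changes the coordinate sum of the position by one, and by rational
  independence that sum is a function of the position.\<close>

lemma (in prob_space) walk_parity:
  assumes indep0: "rationally_independent {1..N} \<alpha>"
    and nonneg: "\<And>i. i \<in> {0..N} \<Longrightarrow> 0 \<le> p i" and "p 0 = 0"
    and indep: "indep_vars (\<lambda>_. borel) u {1..}"
    and law: "\<And>j. j \<ge> 1 \<Longrightarrow> distr M borel (u j) = step_law N \<alpha> p"
    and "odd (int n + (\<Sum>i=1..N. k i))"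
  shows "prob {\<omega>\<in>space M. walk u n \<omega> = (\<Sum>i=1..N. of_int (k i) * \<alpha> i)} = 0"
  using assms(6)
proof (induction n arbitrary: k)
  case 0
  then have "\<exists>i\<in>{1..N}. k i \<noteq> 0" by (metis add_0 dvd_0_right of_nat_0 sum.neutral)
  then have "(\<Sum>i=1..N. of_int (k i) * \<alpha> i) \<noteq> 0"
    using rationally_independent_int_combination[OF indep0] by blast
  then show ?case by (simp add: walk_def)
next
  case (Suc n)
  have upd: "(\<Sum>i=1..N. of_int ((k(j := k j + d)) i) * \<alpha> i) =
        (\<Sum>i=1..N. of_int (k i) * \<alpha> i) + of_int d * \<alpha> j"
      "(\<Sum>i=1..N. (k(j := k j + d)) i) = (\<Sum>i=1..N. k i) + d" if "j \<in> {1..N}" for j d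
    using that by (auto simp: sum.remove[of _ j] algebra_simps)
  have "prob {\<omega>\<in>space M. walk u n \<omega> = (\<Sum>i=1..N. of_int (k i) * \<alpha> i) - \<alpha> j} = 0"
      "prob {\<omega>\<in>space M. walk u n \<omega> = (\<Sum>i=1..N. of_int (k i) * \<alpha> i) + \<alpha> j} = 0"
    if "j \<in> {1..N}" for j
    using Suc.IH[of "k(j := k j + (- 1))"] Suc.IH[of "k(j := k j + 1)"] Suc.prems
    unfolding upd[OF that] by auto
  then show ?case
    by (subst walk_one_step[OF nonneg indep law]) (auto simp: \<open>p 0 = 0\<close>)
qed

section \<open>Fourier inversion on the torus\<close>

text \<open>The characteristic function of a step of the lifted walk on the integer lattice of dimension \<open>N\<close>.\<close>

definition step_char :: "nat \<Rightarrow> (nat \<Rightarrow> real) \<Rightarrow> (nat \<Rightarrow> real) \<Rightarrow> real" where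
  "step_char N p t = p 0 + (\<Sum>i=1..N. p i * cos (t i))"

abbreviation lborel_N :: "nat \<Rightarrow> (nat \<Rightarrow> real) measure" where
  "lborel_N N \<equiv> PiM {1..N} (\<lambda>_. lborel)"

text \<open>The cell has side \<open>2 * pi * L\<close> so that the frequencies in it can be read as \<open>t = s / L\<close>. With
  \<open>L = sqrt n\<close> the integrals over it already live on the scale of the central limit theorem, and no
  change of variables in dimension \<open>N\<close> has to be made.\<close>

definition cell :: "nat \<Rightarrow> real \<Rightarrow> (nat \<Rightarrow> real) \<Rightarrow> real" where
  "cell N L s = (\<Prod>i=1..N. indicator {- (pi * L)..pi * L} (s i))"

text \<open>The cosine replaces the complex exponential because the steps are symmetric, so that
  \<open>step_char\<close> is even in every variable.\<close>

definition fourier_coeff :: "nat \<Rightarrow> (nat \<Rightarrow> real) \<Rightarrow> real \<Rightarrow> nat \<Rightarrow> (nat \<Rightarrow> int) \<Rightarrow> real" where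
  "fourier_coeff N p L m k = (\<integral>s. cell N L s * step_char N p (\<lambda>i. s i / L) ^ m *
     cos (\<Sum>i=1..N. of_int (k i) * (s i / L)) \<partial>lborel_N N)"

interpretation lborel_product: product_sigma_finite "\<lambda>_::nat. lborel :: real measure"
  by (simp add: product_sigma_finite_def lborel.sigma_finite_measure_axioms)

lemma borel_measurable_coordinate [measurable]:
  "i \<in> {1..N} \<Longrightarrow> (\<lambda>s. s i) \<in> borel_measurable (lborel_N N)"
  using measurable_component_singleton[of i "{1..N}" "\<lambda>_. lborel :: real measure"] by simp

lemma borel_measurable_cell [measurable]: "cell N L \<in> borel_measurable (lborel_N N)"
  unfolding cell_def by (intro borel_measurable_prod) measurable

lemma borel_measurable_step_char [measurable]:
  "(\<lambda>s. step_char N p (\<lambda>i. s i / L)) \<in> borel_measurable (lborel_N N)"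
  unfolding step_char_def
  by (intro borel_measurable_add borel_measurable_sum borel_measurable_times) measurable

lemma borel_measurable_phase [measurable]:
  "(\<lambda>s. \<Sum>i=1..N. c i * (s i / L)) \<in> borel_measurable (lborel_N N)"
  by (intro borel_measurable_sum) measurable

lemma cell_cases: "cell N L s = (if \<forall>i\<in>{1..N}. \<bar>s i\<bar> \<le> pi * L then 1 else 0)"
  by (auto simp: cell_def indicator_def abs_le_iff intro!: prod.neutral prod_zero; force)

lemma cell_nonneg: "0 \<le> cell N L s"
  by (auto simp: cell_cases)

lemma integrable_cell: "integrable (lborel_N N) (cell N L)"
  unfolding cell_def[abs_def] by (rule lborel_product.product_integrable_prod)
    (auto intro!: integrable_real_indicator simp: emeasure_lborel_Icc_eq)

lemma integral_cell: "0 \<le> L \<Longrightarrow> integral\<^sup>L (lborel_N N) (cell N L) = (2 * pi * L) ^ N"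
  unfolding cell_def[abs_def] by (subst lborel_product.product_integral_prod)
    (auto intro!: integrable_real_indicator simp: emeasure_lborel_Icc_eq mult_ac)

lemma integrable_cell_mult:
  assumes [measurable]: "f \<in> borel_measurable (lborel_N N)" and "\<And>s. \<bar>f s\<bar> \<le> C"
  shows "integrable (lborel_N N) (\<lambda>s. cell N L s * f s)"
proof (rule Bochner_Integration.integrable_bound)
  show "integrable (lborel_N N) (\<lambda>s. C * cell N L s)"
    using integrable_cell by simp
  show "AE s in lborel_N N. norm (cell N L s * f s) \<le> norm (C * cell N L s)"
    using assms(2) cell_nonneg[of N L] order_trans[OF abs_ge_zero assms(2)]
    by (intro AE_I2) (auto simp: abs_mult mult.commute intro!: mult_right_mono)
qed measurable

lemma step_char_bounds:
  assumes "\<And>i. i \<in> {0..N} \<Longrightarrow> 0 \<le> p i" "(\<Sum>i=0..N. p i) = 1"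
  shows "step_char N p t \<le> 1" "2 * p 0 - 1 \<le> step_char N p t" "\<bar>step_char N p t\<bar> \<le> 1"
proof -
  have s: "p 0 + (\<Sum>i=1..N. p i) = 1"
    using assms(2) by (simp add: sum.atLeast_Suc_atMost)
  have 1: "p i * cos (t i) \<le> p i" "- p i \<le> p i * cos (t i)" if "i \<in> {1..N}" for i
    using assms(1)[of i] that mult_left_mono[of "cos (t i)" 1 "p i"] mult_left_mono[of "-1" "cos (t i)" "p i"]
    by auto
  have "(\<Sum>i=1..N. p i * cos (t i)) \<le> (\<Sum>i=1..N. p i)"
    using 1 by (intro sum_mono) auto
  moreover have "- (\<Sum>i=1..N. p i) \<le> (\<Sum>i=1..N. p i * cos (t i))"
    unfolding sum_negf[symmetric] using 1 by (intro sum_mono) auto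
  ultimately show "step_char N p t \<le> 1" "2 * p 0 - 1 \<le> step_char N p t"
    using s by (auto simp: step_char_def)
  then show "\<bar>step_char N p t\<bar> \<le> 1"
    using assms(1)[of 0] by auto
qed

text \<open>Orthogonality of characters in one variable; the complex form is what factorises over the coordinates.\<close>

lemma integral_cis_period:
  assumes "L > 0"
  shows "has_bochner_integral lborel (\<lambda>x. indicator {- (pi * L)..pi * L} x *\<^sub>R cis (of_int k * (x / L)))
     (if k = 0 then complex_of_real (2 * pi * L) else 0)"
proof (cases "k = 0")
  case True
  have "has_bochner_integral lborel (\<lambda>x. indicator {- (pi * L)..pi * L} x *\<^sub>R (1::complex))
      (complex_of_real (pi * L) - complex_of_real (- (pi * L)))"
    using assms
    by (intro has_bochner_integral_FTC_Icc)
       (auto intro!: derivative_eq_intros has_vector_derivative_of_real simp: mult_nonneg_nonneg)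
  then show ?thesis using True by (simp add: algebra_simps)
next
  case False
  define A where "A = \<i> * of_int k / of_real L"
  have A: "A \<noteq> 0" "cis (of_int k * (x / L)) = exp (x *\<^sub>R A)" for x
    using False assms by (auto simp: A_def cis_conv_exp scaleR_conv_of_real mult_ac)
  define F where "F x = cis (of_int k * (x / L)) * inverse A" for x :: real
  have "has_bochner_integral lborel (\<lambda>x. indicator {- (pi * L)..pi * L} x *\<^sub>R cis (of_int k * (x / L)))
      (F (pi * L) - F (- (pi * L)))"
  proof (rule has_bochner_integral_FTC_Icc)
    fix x
    show "(F has_vector_derivative cis (of_int k * (x / L))) (at x within {- (pi * L)..pi * L})"
      unfolding F_def A(2) using A(1)
        has_vector_derivative_mult_left[OF exp_scaleR_has_vector_derivative_right[of A x], of "inverse A"]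
      by (simp add: mult.assoc has_vector_derivative_at_within)
  qed (use assms in \<open>auto intro!: continuous_intros\<close>)
  moreover have "cis (of_int k * (pi * L / L)) = cis (of_int k * (- (pi * L) / L))"
    using assms by (simp add: complex_eq_iff mult.commute)
  then have "F (pi * L) = F (- (pi * L))" by (simp add: F_def)
  ultimately show ?thesis using False by simp
qed

lemma fourier_coeff_0:
  assumes "L > 0"
  shows "fourier_coeff N p L 0 k = (if \<forall>i\<in>{1..N}. k i = 0 then (2 * pi * L) ^ N else 0)"
proof -
  let ?e = "\<lambda>i x. indicator {- (pi * L)..pi * L} x *\<^sub>R cis (of_int (k i) * (x / L))"
  have prod_cis: "(\<Prod>i=1..N. ?e i (s i)) = cell N L s *\<^sub>R cis (\<Sum>i=1..N. of_int (k i) * (s i / L))" for s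
    by (simp add: cell_def scaleR_conv_of_real prod.distrib cis_conv_exp exp_sum sum_distrib_left)
  note int = has_bochner_integral_iff[THEN iffD1, OF integral_cis_period[OF assms]]
  have "(\<integral>s. (\<Prod>i=1..N. ?e i (s i)) \<partial>lborel_N N) =
      (\<Prod>i=1..N. if k i = 0 then complex_of_real (2 * pi * L) else 0)"
    using int by (subst lborel_product.product_integral_prod) auto
  moreover have "integrable (lborel_N N) (\<lambda>s. \<Prod>i=1..N. ?e i (s i))"
    using int by (intro lborel_product.product_integrable_prod) auto
  ultimately have "(\<integral>s. Re (\<Prod>i=1..N. ?e i (s i)) \<partial>lborel_N N) =
      Re (\<Prod>i=1..N. if k i = 0 then complex_of_real (2 * pi * L) else 0)"
    by simp
  also have "\<dots> = (if \<forall>i\<in>{1..N}. k i = 0 then (2 * pi * L) ^ N else 0)"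
  proof (cases "\<forall>i\<in>{1..N}. k i = 0")
    case True
    then have "(\<Prod>i=1..N. if k i = 0 then complex_of_real (2 * pi * L) else 0) =
        complex_of_real ((2 * pi * L) ^ N)" by simp
    then show ?thesis unfolding if_P[OF True] by (simp only: Re_complex_of_real)
  next
    case False
    then have "(\<Prod>i=1..N. if k i = 0 then complex_of_real (2 * pi * L) else 0) = 0"
      by (intro prod_zero) auto
    then show ?thesis using False by (simp only: if_False) simp
  qed
  finally show ?thesis unfolding prod_cis by (simp add: fourier_coeff_def)
qed

text \<open>Multiplying \<open>cos \<theta>\<close> by \<open>step_char\<close> shifts the frequency, because
  \<open>cos a * cos \<theta> = (cos (\<theta> - a) + cos (\<theta> + a)) / 2\<close>. The outcome is the recursion of
  \<open>walk_one_step\<close>, read on lattice points.\<close>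

lemma fourier_coeff_Suc:
  assumes p: "\<And>i. i \<in> {0..N} \<Longrightarrow> 0 \<le> p i" "(\<Sum>i=0..N. p i) = 1"
  shows "fourier_coeff N p L (Suc m) k = p 0 * fourier_coeff N p L m k + 1 / 2 * (\<Sum>j=1..N. p j *
    (fourier_coeff N p L m (k(j := k j + (- 1))) + fourier_coeff N p L m (k(j := k j + 1))))"
proof -
  define \<theta> where "\<theta> k s = (\<Sum>i=1..N. of_int (k i) * (s i / L))" for k :: "nat \<Rightarrow> int" and s
  define f where "f k s = cell N L s * step_char N p (\<lambda>i. s i / L) ^ m * cos (\<theta> k s)"
    for k :: "nat \<Rightarrow> int" and s
  have int: "integrable (lborel_N N) (f k)" for k
    unfolding f_def \<theta>_def mult.assoc
  proof (rule integrable_cell_mult)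
    show "\<bar>step_char N p (\<lambda>i. s i / L) ^ m * cos (\<Sum>i=1..N. of_int (k i) * (s i / L))\<bar> \<le> 1" for s
      using step_char_bounds(3)[OF p]
      by (auto simp: abs_mult power_abs intro!: mult_le_one power_le_one)
  qed measurable
  have coeff: "integral\<^sup>L (lborel_N N) (f k') = fourier_coeff N p L m k'" for k'
    by (simp add: fourier_coeff_def f_def[abs_def] \<theta>_def)
  have upd: "\<theta> (k(j := k j + d)) s = \<theta> k s + of_int d * (s j / L)" if "j \<in> {1..N}" for j d s
    using that by (auto simp: \<theta>_def sum.remove[of _ j] algebra_simps add_divide_distrib)
  have prod_cos: "cos (s j / L) * cos (\<theta> k s) = 1 / 2 * (cos (\<theta> (k(j := k j + (- 1))) s) + cos (\<theta> (k(j := k j + 1)) s))"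
    if "j \<in> {1..N}" for j s
    unfolding upd[OF that] by (simp add: cos_add cos_diff)
  have "cell N L s * step_char N p (\<lambda>i. s i / L) ^ Suc m * cos (\<theta> k s) =
      p 0 * f k s + (\<Sum>j=1..N. p j * (1 / 2 * (f (k(j := k j + (- 1))) s + f (k(j := k j + 1)) s)))"
      (is "?l s = ?r s") for s
  proof -
    define c where "c = cell N L s * step_char N p (\<lambda>i. s i / L) ^ m"
    have "?l s = c * (p 0 * cos (\<theta> k s) + (\<Sum>j=1..N. p j * (cos (s j / L) * cos (\<theta> k s))))"
      unfolding c_def by (simp add: step_char_def[of N p "\<lambda>i. s i / L"] algebra_simps sum_distrib_left)
    also have "\<dots> = c * (p 0 * cos (\<theta> k s) + (\<Sum>j=1..N. p j *
        (1 / 2 * (cos (\<theta> (k(j := k j + (- 1))) s) + cos (\<theta> (k(j := k j + 1)) s)))))"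
      by (intro arg_cong[where f="\<lambda>y. c * (p 0 * cos (\<theta> k s) + y)"] sum.cong refl) (simp only: prod_cos)
    also have "\<dots> = ?r s"
      unfolding f_def c_def[symmetric] by (simp add: sum_distrib_left distrib_left mult_ac)
    finally show ?thesis .
  qed
  then have "fourier_coeff N p L (Suc m) k = integral\<^sup>L (lborel_N N) ?r"
    unfolding fourier_coeff_def \<theta>_def[symmetric] by (simp only:)
  also have "\<dots> = p 0 * integral\<^sup>L (lborel_N N) (f k) + (\<Sum>j=1..N. p j * (1 / 2 *
      (integral\<^sup>L (lborel_N N) (f (k(j := k j + (- 1)))) + integral\<^sup>L (lborel_N N) (f (k(j := k j + 1))))))"
    using int by (simp add: fun_upd_def)
  finally show ?thesis
    unfolding coeff by (simp add: sum_distrib_left mult_ac fun_upd_def)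
qed

text \<open>Both sides satisfy the same recursion in \<open>m\<close>. At time \<open>0\<close> they agree because the real number
  \<open>\<Sum>i=1..N. k i * \<alpha> i\<close> vanishes only if all \<open>k i\<close> do: this is where rational independence turns
  the walk on the line into a walk on the lattice.\<close>

lemma (in prob_space) fourier_inversion:
  assumes "L > 0"
    and indep0: "rationally_independent {1..N} \<alpha>"
    and nonneg: "\<And>i. i \<in> {0..N} \<Longrightarrow> 0 \<le> p i" and total: "(\<Sum>i=0..N. p i) = 1"
    and indep: "indep_vars (\<lambda>_. borel) u {1..}"
    and law: "\<And>j. j \<ge> 1 \<Longrightarrow> distr M borel (u j) = step_law N \<alpha> p"
  shows "fourier_coeff N p L m k =
    (2 * pi * L) ^ N * prob {\<omega>\<in>space M. walk u m \<omega> = (\<Sum>i=1..N. of_int (k i) * \<alpha> i)}"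
proof (induction m arbitrary: k)
  case 0
  have "(\<Sum>i=1..N. of_int (k i) * \<alpha> i) = 0 \<longleftrightarrow> (\<forall>i\<in>{1..N}. k i = 0)"
    using rationally_independent_int_combination[OF indep0, of k] by (auto intro!: sum.neutral)
  moreover have "prob {\<omega>\<in>space M. walk u 0 \<omega> = x} = (if x = 0 then 1 else 0)" for x
    by (simp add: walk_def prob_space)
  ultimately show ?case
    by (simp only: fourier_coeff_0[OF assms(1)]) simp
next
  case (Suc m)
  have upd: "(\<Sum>i=1..N. of_int ((k(j := k j + d)) i) * \<alpha> i) =
        (\<Sum>i=1..N. of_int (k i) * \<alpha> i) + of_int d * \<alpha> j" if "j \<in> {1..N}" for j d
    using that by (auto simp: sum.remove[of _ j] algebra_simps)
  define h where "h x = prob {\<omega>\<in>space M. walk u m \<omega> = x}" for x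
  define x where "x = (\<Sum>i=1..N. of_int (k i) * \<alpha> i)"
  have IH: "fourier_coeff N p L m k' = (2 * pi * L) ^ N * h (\<Sum>i=1..N. of_int (k' i) * \<alpha> i)" for k'
    unfolding h_def by (rule Suc.IH)
  have "fourier_coeff N p L (Suc m) k = p 0 * ((2 * pi * L) ^ N * h x) + 1 / 2 * (\<Sum>j=1..N. p j *
      ((2 * pi * L) ^ N * h (x - \<alpha> j) + (2 * pi * L) ^ N * h (x + \<alpha> j)))"
  proof -
    have "h (x - \<alpha> j) = h (\<Sum>i=1..N. of_int ((k(j := k j + (- 1))) i) * \<alpha> i)"
      "h (x + \<alpha> j) = h (\<Sum>i=1..N. of_int ((k(j := k j + 1)) i) * \<alpha> i)" if "j \<in> {1..N}" for j
      unfolding upd[OF that] by (simp_all add: x_def)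
    moreover have "fourier_coeff N p L (Suc m) k = p 0 * fourier_coeff N p L m k + 1 / 2 * (\<Sum>j=1..N. p j *
        (fourier_coeff N p L m (k(j := k j + (- 1))) + fourier_coeff N p L m (k(j := k j + 1))))"
      by (rule fourier_coeff_Suc[OF nonneg total])
    ultimately show ?thesis by (simp only: IH x_def cong: sum.cong)
  qed
  also have "\<dots> = (2 * pi * L) ^ N * (p 0 * h x + 1 / 2 * (\<Sum>j=1..N. p j * (h (x - \<alpha> j) + h (x + \<alpha> j))))"
    by (simp add: algebra_simps sum_distrib_left)
  also have "p 0 * h x + 1 / 2 * (\<Sum>j=1..N. p j * (h (x - \<alpha> j) + h (x + \<alpha> j))) =
      prob {\<omega>\<in>space M. walk u (Suc m) \<omega> = x}"
    unfolding h_def by (rule walk_one_step[OF nonneg indep law, symmetric]) auto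
  finally show ?case by (simp add: x_def)
qed

section \<open>Analytic estimates\<close>

text \<open>Any positive constant in place of \<open>1 / 18\<close> serves for the Gaussian domination; this one needs only
  \<open>pi < 4\<close>. It comes from \<open>1 - cos t = 2 * sin\<^sup>2 (t / 2)\<close> and \<open>sin x \<ge> x - x ^ 3 / 6 \<ge> x / 3\<close> on \<open>[0, 2]\<close>.\<close>

lemma cos_le_one_minus_quadratic:
  assumes "\<bar>t\<bar> \<le> pi"
  shows "cos t \<le> 1 - t\<^sup>2 / 18"
proof -
  define x where "x = \<bar>t\<bar> / 2"
  have x: "0 \<le> x" "x \<le> 2" using assms pi_less_4 by (auto simp: x_def)
  have "\<bar>sin x - x\<bar> \<le> \<bar>x\<bar> ^ 3 / 6"
    using Maclaurin_sin_bound[of x 3] by (simp add: eval_nat_numeral sin_coeff_def fact_numeral)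
  moreover have "x ^ 3 \<le> 4 * x"
    using x mult_mono[of "x * x" 4 x x] mult_mono[of x 2 x 2] by (simp add: eval_nat_numeral)
  ultimately have "x / 3 \<le> sin x" using x by (auto simp: abs_if split: if_splits)
  then have "(x / 3)\<^sup>2 \<le> (sin x)\<^sup>2" using x by (intro power_mono) auto
  moreover have "cos t = 1 - 2 * (sin x)\<^sup>2"
    using cos_double_sin[of x] by (simp add: x_def)
  ultimately show ?thesis by (simp add: x_def power_divide)
qed

text \<open>The limit \<open>(1 + x / n) ^ n \<longlonglongrightarrow> exp x\<close> with room for a perturbed numerator and a perturbed exponent.
  The exponents \<open>n - 1\<close> and \<open>n + 1\<close> occur in the case without lazy steps. The truncation at \<open>0\<close> is
  invisible in the limit, as \<open>1 + y n\<close> is eventually positive.\<close>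

lemma tendsto_power_exp:
  fixes y :: "nat \<Rightarrow> real"
  assumes y: "(\<lambda>n. real n * y n) \<longlonglongrightarrow> x" and m: "(\<lambda>n. real (m n) / real n) \<longlonglongrightarrow> 1"
  shows "(\<lambda>n. (max 0 (1 + y n)) ^ m n) \<longlonglongrightarrow> exp x"
proof -
  have y0: "y \<longlonglongrightarrow> 0"
  proof (rule Lim_transform_eventually)
    show "(\<lambda>n. (real n * y n) * (1 / real n)) \<longlonglongrightarrow> 0"
      using tendsto_mult[OF y lim_1_over_n] by simp
    show "eventually (\<lambda>n. (real n * y n) * (1 / real n) = y n) sequentially"
      using eventually_gt_at_top[of 0] by eventually_elim simp
  qed
  then have small: "eventually (\<lambda>n. \<bar>y n\<bar> < 1 / 2) sequentially"
    using order_tendstoD(2)[OF tendsto_rabs[OF y0], of "1/2"] by simp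
  have "(\<lambda>n. real n * ln (1 + y n) - real n * y n) \<longlonglongrightarrow> 0"
  proof (rule Lim_null_comparison)
    show "eventually (\<lambda>n. norm (real n * ln (1 + y n) - real n * y n) \<le> 2 * \<bar>real n * y n\<bar> * \<bar>y n\<bar>) sequentially"
      using small
    proof eventually_elim
      case (elim n)
      then have "\<bar>ln (1 + y n) - y n\<bar> \<le> 2 * (y n)\<^sup>2"
        by (intro abs_ln_one_plus_x_minus_x_bound) auto
      then have "real n * \<bar>ln (1 + y n) - y n\<bar> \<le> real n * (2 * (y n)\<^sup>2)"
        by (intro mult_left_mono) auto
      then show ?case
        by (simp add: abs_mult right_diff_distrib[symmetric] power2_eq_square mult_ac)
    qed
    show "(\<lambda>n. 2 * \<bar>real n * y n\<bar> * \<bar>y n\<bar>) \<longlonglongrightarrow> 0"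
      using tendsto_mult[OF tendsto_mult[OF tendsto_const[of 2] tendsto_rabs[OF y]] tendsto_rabs[OF y0]] by simp
  qed
  then have "(\<lambda>n. real n * ln (1 + y n)) \<longlonglongrightarrow> x"
    using tendsto_add[OF _ y] by fastforce
  then have "(\<lambda>n. exp (real (m n) / real n * (real n * ln (1 + y n)))) \<longlonglongrightarrow> exp x"
    using tendsto_exp[OF tendsto_mult[OF m]] by fastforce
  moreover have "eventually (\<lambda>n. exp (real (m n) / real n * (real n * ln (1 + y n))) =
      (max 0 (1 + y n)) ^ m n) sequentially"
    using small eventually_gt_at_top[of 0]
    by eventually_elim (auto simp: exp_of_nat_mult max_def abs_if split: if_splits)
  ultimately show ?thesis by (rule Lim_transform_eventually)
qed

lemma gaussian_integral:
  assumes "a > 0"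
  shows "integrable lborel (\<lambda>x::real. exp (- (a * x\<^sup>2)))"
    and "(\<integral>x. exp (- (a * x\<^sup>2)) \<partial>lborel) = sqrt (pi / a)"
proof -
  define \<sigma> where "\<sigma> = sqrt (1 / (2 * a))"
  have \<sigma>: "\<sigma> > 0" "2 * \<sigma>\<^sup>2 = 1 / a" using assms by (auto simp: \<sigma>_def)
  have "sqrt (2 * pi * \<sigma>\<^sup>2) = sqrt (pi / a)" using \<sigma>(2) by (simp add: mult_ac)
  moreover have "- (x - 0)\<^sup>2 / (2 * \<sigma>\<^sup>2) = - (a * x\<^sup>2)" for x unfolding \<sigma>(2) by simp
  ultimately have "normal_density 0 \<sigma> x = 1 / sqrt (pi / a) * exp (- (a * x\<^sup>2))" for x
    unfolding normal_density_def by simp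
  then have *: "exp (- (a * x\<^sup>2)) = sqrt (pi / a) * normal_density 0 \<sigma> x" for x
    using assms by (simp add: field_simps)
  show "integrable lborel (\<lambda>x::real. exp (- (a * x\<^sup>2)))"
    unfolding * using \<sigma>(1) by (intro integrable_mult_right) auto
  show "(\<integral>x. exp (- (a * x\<^sup>2)) \<partial>lborel) = sqrt (pi / a)"
    unfolding * using \<sigma>(1) by simp
qed

lemma gaussian_integral_product:
  assumes "\<And>i. i \<in> {1..N} \<Longrightarrow> 0 < a i"
  shows "integrable (lborel_N N) (\<lambda>s. exp (- (\<Sum>i=1..N. a i * (s i)\<^sup>2)))"
    and "(\<integral>s. exp (- (\<Sum>i=1..N. a i * (s i)\<^sup>2)) \<partial>lborel_N N) = (\<Prod>i=1..N. sqrt (pi / a i))"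
proof -
  have *: "exp (- (\<Sum>i=1..N. a i * (s i)\<^sup>2)) = (\<Prod>i=1..N. exp (- (a i * (s i)\<^sup>2)))" for s :: "nat \<Rightarrow> real"
    by (simp add: exp_sum sum_negf[symmetric])
  show "integrable (lborel_N N) (\<lambda>s. exp (- (\<Sum>i=1..N. a i * (s i)\<^sup>2)))"
    unfolding * using assms gaussian_integral(1)
    by (intro lborel_product.product_integrable_prod[of _ "\<lambda>i x. exp (- (a i * x\<^sup>2))"]) auto
  show "(\<integral>s. exp (- (\<Sum>i=1..N. a i * (s i)\<^sup>2)) \<partial>lborel_N N) = (\<Prod>i=1..N. sqrt (pi / a i))"
    unfolding * using assms gaussian_integral
    by (subst lborel_product.product_integral_prod[of _ "\<lambda>i x. exp (- (a i * x\<^sup>2))"]) auto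
qed

section \<open>Asymptotics of the Fourier integral\<close>

text \<open>The sign of \<open>step_char\<close> separates the peak of value \<open>1\<close> at the frequency \<open>0\<close> from the one of value
  \<open>- 1\<close> that appears at \<open>(pi, \<dots>, pi)\<close> if \<open>p 0 = 0\<close>. In contrast to a split into neighbourhoods of
  the peaks it leaves no remainder: the whole integral is the sum of the two, up to the sign
  \<open>(- 1) ^ m\<close> of the second.\<close>

definition positive_part_integral :: "nat \<Rightarrow> (nat \<Rightarrow> real) \<Rightarrow> real \<Rightarrow> nat \<Rightarrow> real" where
  "positive_part_integral N p L m =
     (\<integral>s. cell N L s * (max 0 (step_char N p (\<lambda>i. s i / L))) ^ m \<partial>lborel_N N)"

definition negative_part_integral :: "nat \<Rightarrow> (nat \<Rightarrow> real) \<Rightarrow> real \<Rightarrow> nat \<Rightarrow> real" where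
  "negative_part_integral N p L m =
     (\<integral>s. cell N L s * (max 0 (- step_char N p (\<lambda>i. s i / L))) ^ m \<partial>lborel_N N)"

lemma integrable_parts:
  assumes p: "\<And>i. i \<in> {0..N} \<Longrightarrow> 0 \<le> p i" "(\<Sum>i=0..N. p i) = 1"
  shows "integrable (lborel_N N) (\<lambda>s. cell N L s * (max 0 (step_char N p (\<lambda>i. s i / L))) ^ m)"
    "integrable (lborel_N N) (\<lambda>s. cell N L s * (max 0 (- step_char N p (\<lambda>i. s i / L))) ^ m)"
proof -
  have "\<bar>max 0 (step_char N p t) ^ m\<bar> \<le> 1" "\<bar>max 0 (- step_char N p t) ^ m\<bar> \<le> 1" for t
    using step_char_bounds(3)[OF p, of t] by (auto simp: power_abs abs_le_iff intro!: power_le_one)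
  note le = this
  show "integrable (lborel_N N) (\<lambda>s. cell N L s * (max 0 (step_char N p (\<lambda>i. s i / L))) ^ m)"
    by (rule integrable_cell_mult[OF _ le(1)]) measurable
  show "integrable (lborel_N N) (\<lambda>s. cell N L s * (max 0 (- step_char N p (\<lambda>i. s i / L))) ^ m)"
    by (rule integrable_cell_mult[OF _ le(2)]) measurable
qed

lemma parts_antimono:
  assumes p: "\<And>i. i \<in> {0..N} \<Longrightarrow> 0 \<le> p i" "(\<Sum>i=0..N. p i) = 1" and "m \<le> m'"
  shows "positive_part_integral N p L m' \<le> positive_part_integral N p L m"
    "negative_part_integral N p L m' \<le> negative_part_integral N p L m"
proof -
  have "max 0 (step_char N p t) ^ m' \<le> max 0 (step_char N p t) ^ m"
    "max 0 (- step_char N p t) ^ m' \<le> max 0 (- step_char N p t) ^ m" for t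
    using step_char_bounds(3)[OF p, of t] \<open>m \<le> m'\<close> by (auto intro!: power_decreasing simp: abs_le_iff)
  then have "cell N L s * max 0 (step_char N p t) ^ m' \<le> cell N L s * max 0 (step_char N p t) ^ m"
    "cell N L s * max 0 (- step_char N p t) ^ m' \<le> cell N L s * max 0 (- step_char N p t) ^ m" for s t
    using cell_nonneg by (auto intro: mult_left_mono)
  note le = this
  show "positive_part_integral N p L m' \<le> positive_part_integral N p L m"
    unfolding positive_part_integral_def
    by (intro integral_mono integrable_parts(1) p le(1))
  show "negative_part_integral N p L m' \<le> negative_part_integral N p L m"
    unfolding negative_part_integral_def
    by (intro integral_mono integrable_parts(2) p le(2))
qed

lemma fourier_coeff_parts:
  assumes p: "\<And>i. i \<in> {0..N} \<Longrightarrow> 0 \<le> p i" "(\<Sum>i=0..N. p i) = 1" and "m > 0"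
  shows "fourier_coeff N p L m (\<lambda>_. 0) =
    positive_part_integral N p L m + (- 1) ^ m * negative_part_integral N p L m"
proof -
  have split: "x ^ m = max 0 x ^ m + (- 1) ^ m * max 0 (- x) ^ m" for x :: real
  proof (cases "x \<ge> 0")
    case True
    then have "max 0 x = x" "max 0 (- x) = 0" by auto
    then show ?thesis using \<open>m > 0\<close> by (simp add: zero_power)
  next
    case False
    then have eq: "max 0 x = 0" "max 0 (- x) = - x" by auto
    have "(- 1) ^ m * (- x) ^ m = ((- 1) * (- x)) ^ m" by (rule power_mult_distrib[symmetric])
    also have "(- 1) * (- x) = x" by simp
    finally show ?thesis unfolding eq by (simp only: zero_power[OF \<open>m > 0\<close>] add_0)
  qed
  let ?\<phi> = "\<lambda>s. step_char N p (\<lambda>i. s i / L)"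
  have "cell N L s * ?\<phi> s ^ m * cos (\<Sum>i=1..N. of_int 0 * (s i / L)) =
      cell N L s * max 0 (?\<phi> s) ^ m + (- 1) ^ m * (cell N L s * max 0 (- ?\<phi> s) ^ m)" for s
    by (subst split) (simp add: distrib_left mult.left_commute)
  then have "fourier_coeff N p L m (\<lambda>_. 0) = (\<integral>s. cell N L s * max 0 (?\<phi> s) ^ m +
      (- 1) ^ m * (cell N L s * max 0 (- ?\<phi> s) ^ m) \<partial>lborel_N N)"
    unfolding fourier_coeff_def by (simp only:)
  then show ?thesis
    using integrable_parts[OF p] by (simp add: positive_part_integral_def negative_part_integral_def)
qed

text \<open>Laplace's method. Where \<open>step_char\<close> is positive, \<open>cos t \<le> 1 - t\<^sup>2 / 18\<close> bounds it by a Gaussian,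
  uniformly on the whole cell and not only near \<open>0\<close>, so dominated convergence applies; pointwise,
  \<open>n * (cos (c / sqrt n) - 1)\<close> tends to \<open>- c\<^sup>2 / 2\<close>.\<close>

lemma positive_part_integral_limit:
  assumes p0: "0 \<le> p 0" and pos: "\<And>i. i \<in> {1..N} \<Longrightarrow> 0 < p i" and total: "(\<Sum>i=0..N. p i) = 1"
    and m: "(\<lambda>n. real (m n) / real n) \<longlonglongrightarrow> 1"
  shows "(\<lambda>n. positive_part_integral N p (sqrt (real n)) (m n)) \<longlonglongrightarrow> (\<Prod>i=1..N. sqrt (2 * pi / p i))"
proof -
  have total': "p 0 + (\<Sum>i=1..N. p i) = 1"
    using total by (simp add: sum.atLeast_Suc_atMost)
  let ?f = "\<lambda>n s. cell N (sqrt (real n)) s * (max 0 (step_char N p (\<lambda>i. s i / sqrt (real n)))) ^ m n"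
  have step_char_eq: "step_char N p t = 1 + (\<Sum>i=1..N. p i * (cos (t i) - 1))" for t
    using total' by (simp add: step_char_def sum_subtractf right_diff_distrib)
  have "eventually (\<lambda>n. 1 / 2 < real (m n) / real n) sequentially"
    using order_tendstoD(1)[OF m, of "1/2"] by simp
  then obtain n0 where n0: "\<And>n. n \<ge> n0 \<Longrightarrow> 1 / 2 < real (m n) / real n"
    by (auto simp: eventually_sequentially)
  have dominated: "norm (?f n s) \<le> exp (- (\<Sum>i=1..N. p i / 36 * (s i)\<^sup>2))" if "n \<ge> n0" for n s
  proof (cases "\<forall>i\<in>{1..N}. \<bar>s i\<bar> \<le> pi * sqrt (real n)")
    case True
    have n: "n > 0" using n0[OF that] by (cases n) auto
    define Q where "Q = (\<Sum>i=1..N. p i * (s i)\<^sup>2)"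
    have "Q \<ge> 0" using pos unfolding Q_def by (intro sum_nonneg mult_nonneg_nonneg) (auto intro: less_imp_le)
    have "p i * (cos (s i / sqrt (real n)) - 1) \<le> p i * (- ((s i)\<^sup>2 / (18 * real n)))" if "i \<in> {1..N}" for i
    proof (rule mult_left_mono)
      have "\<bar>s i / sqrt (real n)\<bar> \<le> pi" using True that n by (auto simp: abs_divide field_simps)
      from cos_le_one_minus_quadratic[OF this] show "cos (s i / sqrt (real n)) - 1 \<le> - ((s i)\<^sup>2 / (18 * real n))"
        by (simp add: power_divide mult.commute)
    qed (use pos[OF that] in auto)
    then have "(\<Sum>i=1..N. p i * (cos (s i / sqrt (real n)) - 1)) \<le> (\<Sum>i=1..N. p i * (- ((s i)\<^sup>2 / (18 * real n))))"
      by (rule sum_mono)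
    also have "\<dots> = - (Q / (18 * real n))" by (simp add: Q_def sum_divide_distrib sum_negf)
    finally have "step_char N p (\<lambda>i. s i / sqrt (real n)) \<le> 1 + - (Q / (18 * real n))"
      by (simp add: step_char_eq)
    also have "\<dots> \<le> exp (- (Q / (18 * real n)))" by (rule exp_ge_add_one_self)
    finally have "max 0 (step_char N p (\<lambda>i. s i / sqrt (real n))) ^ m n \<le> exp (- (Q / (18 * real n))) ^ m n"
      by (intro power_mono) auto
    also have "\<dots> = exp (- (real (m n) / real n * (Q / 18)))" by (simp add: exp_of_nat_mult[symmetric])
    also have "\<dots> \<le> exp (- (1 / 2 * (Q / 18)))"
      using n0[OF that] \<open>Q \<ge> 0\<close> unfolding exp_le_cancel_iff neg_le_iff_le by (intro mult_right_mono) auto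
    also have "1 / 2 * (Q / 18) = (\<Sum>i=1..N. p i / 36 * (s i)\<^sup>2)" by (simp add: Q_def sum_divide_distrib)
    finally show ?thesis using True by (simp add: cell_cases)
  qed (auto simp: cell_cases)
  have pointwise: "(\<lambda>n. ?f n s) \<longlonglongrightarrow> exp (- (\<Sum>i=1..N. p i / 2 * (s i)\<^sup>2))" for s
  proof -
    have "eventually (\<lambda>n. \<bar>s i\<bar> \<le> pi * sqrt (real n)) sequentially" for i
    proof -
      have "filterlim (\<lambda>n. pi * sqrt (real n)) at_top sequentially" by real_asymp
      then show ?thesis by (simp add: filterlim_at_top)
    qed
    then have "eventually (\<lambda>n. \<forall>i\<in>{1..N}. \<bar>s i\<bar> \<le> pi * sqrt (real n)) sequentially"
      by (intro eventually_ball_finite) auto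
    then have cell1: "(\<lambda>n. cell N (sqrt (real n)) s) \<longlonglongrightarrow> 1"
      by (intro tendsto_eventually) (auto simp: cell_cases elim!: eventually_mono)
    have "(\<lambda>n. real n * (cos (c / sqrt (real n)) - 1)) \<longlonglongrightarrow> - (c * c / 2)" for c :: real
    proof -
      consider "c = 0" | "c > 0" | "c < 0" by linarith
      then show ?thesis
      proof cases
        case 1
        then show ?thesis by simp
      qed real_asymp+
    qed
    then have "(\<lambda>n. \<Sum>i=1..N. p i * (real n * (cos (s i / sqrt (real n)) - 1))) \<longlonglongrightarrow> (\<Sum>i=1..N. p i * (- (s i * s i / 2)))"
      by (intro tendsto_intros)
    then have "(\<lambda>n. real n * (\<Sum>i=1..N. p i * (cos (s i / sqrt (real n)) - 1))) \<longlonglongrightarrow> - (\<Sum>i=1..N. p i / 2 * (s i)\<^sup>2)"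
      by (simp add: sum_distrib_left mult_ac sum_negf power2_eq_square)
    from tendsto_mult[OF cell1 tendsto_power_exp[OF this m]] show ?thesis by (simp add: step_char_eq)
  qed
  \<comment> \<open>The domination holds only once \<open>m n\<close> exceeds \<open>n / 2\<close>, hence the shift by \<open>n0\<close>.\<close>
  have "(\<lambda>n. \<integral>s. ?f (n + n0) s \<partial>lborel_N N) \<longlonglongrightarrow> (\<integral>s. exp (- (\<Sum>i=1..N. p i / 2 * (s i)\<^sup>2)) \<partial>lborel_N N)"
  proof (rule integral_dominated_convergence)
    show "integrable (lborel_N N) (\<lambda>s. exp (- (\<Sum>i=1..N. p i / 36 * (s i)\<^sup>2)))"
      using pos by (intro gaussian_integral_product) auto
    show "(\<lambda>s. exp (- (\<Sum>i=1..N. p i / 2 * (s i)\<^sup>2))) \<in> borel_measurable (lborel_N N)"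
      using pos by (intro borel_measurable_integrable gaussian_integral_product) auto
    show "AE s in lborel_N N. (\<lambda>n. ?f (n + n0) s) \<longlonglongrightarrow> exp (- (\<Sum>i=1..N. p i / 2 * (s i)\<^sup>2))"
      by (rule AE_I2) (rule LIMSEQ_ignore_initial_segment[OF pointwise])
    show "AE s in lborel_N N. norm (?f (n + n0) s) \<le> exp (- (\<Sum>i=1..N. p i / 36 * (s i)\<^sup>2))" for n
      by (rule AE_I2) (rule dominated, simp)
  qed measurable
  also have "(\<integral>s. exp (- (\<Sum>i=1..N. p i / 2 * (s i)\<^sup>2)) \<partial>lborel_N N) = (\<Prod>i=1..N. sqrt (2 * pi / p i))"
    using pos by (subst gaussian_integral_product) (auto simp: mult.commute)
  finally show ?thesis
    unfolding positive_part_integral_def by (rule LIMSEQ_offset)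
qed

text \<open>With \<open>p 0 > 0\<close> the value \<open>2 * p 0 - 1\<close> is a lower bound of \<open>step_char\<close> that exceeds \<open>- 1\<close>, and the
  exponential decay beats the polynomial volume of the cell.\<close>

lemma negative_part_integral_null:
  assumes p: "\<And>i. i \<in> {0..N} \<Longrightarrow> 0 \<le> p i" "(\<Sum>i=0..N. p i) = 1" and "p 0 > 0"
  shows "(\<lambda>n. negative_part_integral N p (sqrt (real n)) n) \<longlonglongrightarrow> 0"
proof -
  define q where "q = max 0 (1 - 2 * p 0)"
  have q: "0 \<le> q" "q < 1" using \<open>p 0 > 0\<close> by (auto simp: q_def)
  have bound: "negative_part_integral N p L n \<le> (2 * pi * L) ^ N * q ^ n" if "L \<ge> 0" for L n
  proof -
    have le: "max 0 (- step_char N p t) \<le> q" for t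
      using step_char_bounds(2)[OF p, of t] by (auto simp: q_def)
    have "negative_part_integral N p L n \<le> (\<integral>s. cell N L s * q ^ n \<partial>lborel_N N)"
      unfolding negative_part_integral_def
    proof (rule integral_mono)
      show "integrable (lborel_N N) (\<lambda>s. cell N L s * (max 0 (- step_char N p (\<lambda>i. s i / L))) ^ n)"
        by (rule integrable_parts(2)[OF p])
      show "cell N L s * (max 0 (- step_char N p (\<lambda>i. s i / L))) ^ n \<le> cell N L s * q ^ n" for s
        by (intro mult_left_mono power_mono le cell_nonneg) simp
    qed (use integrable_cell in simp)
    then show ?thesis using integral_cell[OF that] by simp
  qed
  have "(\<lambda>n. (2 * pi * sqrt (real n)) ^ N * q ^ n) \<longlonglongrightarrow> 0"
  proof (cases "q = 0")
    case True
    have "eventually (\<lambda>n. (2 * pi * sqrt (real n)) ^ N * q ^ n = 0) sequentially"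
      using eventually_gt_at_top[of 0] by eventually_elim (simp add: True zero_power)
    then show ?thesis by (rule tendsto_eventually)
  next
    case False
    then have "q > 0" using q by simp
    then have "(\<lambda>n. (2 * pi) ^ N * (real n powr (real N / 2) * q ^ n)) \<longlonglongrightarrow> 0"
      using q(2) by real_asymp
    moreover have "eventually (\<lambda>n. (2 * pi) ^ N * (real n powr (real N / 2) * q ^ n) =
        (2 * pi * sqrt (real n)) ^ N * q ^ n) sequentially"
      using eventually_gt_at_top[of 0]
      by eventually_elim (simp add: power_mult_distrib powr_half_sqrt[symmetric] powr_powr flip: powr_realpow)
    ultimately show ?thesis by (rule Lim_transform_eventually)
  qed
  then show ?thesis
  proof (rule Lim_null_comparison[rotated], intro always_eventually allI)
    fix n
    have "0 \<le> negative_part_integral N p (sqrt (real n)) n"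
      unfolding negative_part_integral_def by (intro integral_nonneg_AE AE_I2 mult_nonneg_nonneg cell_nonneg) simp
    then show "norm (negative_part_integral N p (sqrt (real n)) n) \<le> (2 * pi * sqrt (real n)) ^ N * q ^ n"
      using bound[of "sqrt (real n)" n] by simp
  qed
qed

text \<open>The Gaussian limit is \<open>(2 * pi) ^ N * C_const N p\<close>, since
  \<open>sqrt (2 * pi / p i) = 2 * pi / sqrt (2 * pi * p i)\<close>; the general filter covers both the full
  sequence and the even numbers.\<close>

lemma asymp_equiv_from_scaled_limit:
  assumes pos: "\<And>i. i \<in> {1..N} \<Longrightarrow> 0 < p i" and "c \<noteq> 0" and F: "F \<le> sequentially"
    and lim: "((\<lambda>n. (2 * pi * sqrt (real n)) ^ N * r n) \<longlongrightarrow> c * (\<Prod>i=1..N. sqrt (2 * pi / p i))) F"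
  shows "r \<sim>[F] (\<lambda>n. c * C_const N p / real n powr (real N / 2))"
proof (rule asymp_equivI')
  define K where "K = (\<Prod>i=1..N. sqrt (2 * pi / p i))"
  have "sqrt (2 * pi / p i) = 2 * pi * (1 / sqrt (2 * pi * p i))" if "i \<in> {1..N}" for i
  proof -
    have "sqrt (2 * pi / p i) = sqrt ((2 * pi)\<^sup>2 / (2 * pi * p i))"
      using pos[OF that] by (simp add: power2_eq_square)
    also have "\<dots> = 2 * pi * (1 / sqrt (2 * pi * p i))" by (simp only: real_sqrt_divide real_sqrt_abs) simp
    finally show ?thesis .
  qed
  then have "K = (\<Prod>i=1..N. 2 * pi * (1 / sqrt (2 * pi * p i)))"
    unfolding K_def by (rule prod.cong[OF refl])
  then have K: "K = (2 * pi) ^ N * C_const N p" by (simp only: prod.distrib C_const_def) simp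
  have "K > 0" unfolding K_def using pos by (intro prod_pos) simp
  then have C: "C_const N p \<noteq> 0" using K by auto
  have "((\<lambda>n. (2 * pi * sqrt (real n)) ^ N * r n / (c * K)) \<longlongrightarrow> c * K / (c * K)) F"
    using lim[folded K_def] \<open>K > 0\<close> \<open>c \<noteq> 0\<close> by (intro tendsto_divide tendsto_const) auto
  then have "((\<lambda>n. (2 * pi * sqrt (real n)) ^ N * r n / (c * K)) \<longlongrightarrow> 1) F"
    using \<open>K > 0\<close> \<open>c \<noteq> 0\<close> by simp
  moreover have "eventually (\<lambda>n. (2 * pi * sqrt (real n)) ^ N * r n / (c * K) =
      r n / (c * C_const N p / real n powr (real N / 2))) F"
    using filter_leD[OF F eventually_gt_at_top[of 0]]
  proof eventually_elim
    case (elim n)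
    then have "(2 * pi * sqrt (real n)) ^ N = (2 * pi) ^ N * real n powr (real N / 2)"
      by (simp add: power_mult_distrib powr_half_sqrt[symmetric] powr_powr flip: powr_realpow)
    then show ?case using C \<open>c \<noteq> 0\<close> elim unfolding K by (simp add: field_simps)
  qed
  ultimately show "((\<lambda>n. r n / (c * C_const N p / real n powr (real N / 2))) \<longlongrightarrow> 1) F"
    by (rule Lim_transform_eventually)
qed

section \<open>Asymptotics of the return probabilities\<close>

theorem proposition4p3:
  fixes N :: nat and \<alpha> p :: "nat \<Rightarrow> real"
    and M :: "'a measure" and u :: "nat \<Rightarrow> 'a \<Rightarrow> real"
  assumes "N \<ge> 1"
    and "rationally_independent {1..N} \<alpha>"
    and "p 0 \<ge> 0"
    and "\<And>i. i \<in> {1..N} \<Longrightarrow> 0 < p i \<and> p i < 1"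
    and "(\<Sum>i=0..N. p i) = 1"
    and "prob_space M"
    and "prob_space.indep_vars M (\<lambda>_. borel) u {1..}"
    and "\<And>j. j \<ge> 1 \<Longrightarrow> distr M borel (u j) = step_law N \<alpha> p"
  shows "(p 0 > 0 \<longrightarrow>
            return_prob M u \<sim>[sequentially] (\<lambda>n. C_const N p / real n powr (real N / 2)))
       \<and> (p 0 = 0 \<longrightarrow>
            (\<forall>n. odd n \<longrightarrow> return_prob M u n = 0) \<and>
            return_prob M u \<sim>[inf sequentially (principal {n. even n})]
              (\<lambda>n. 2 * C_const N p / real n powr (real N / 2)))"
proof -
  interpret prob_space M by fact
  have pos: "0 < p i" if "i \<in> {1..N}" for i using assms(4)[OF that] by simp
  have p: "0 \<le> p i" if "i \<in> {0..N}" for i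
    using assms(3) pos[of i] that by (cases "i = 0") auto
  let ?r = "return_prob M u" and ?K = "\<Prod>i=1..N. sqrt (2 * pi / p i)"
  let ?A = "positive_part_integral N p" and ?B = "negative_part_integral N p"
  have scaled: "(2 * pi * L) ^ N * ?r m = ?A L m + (- 1) ^ m * ?B L m" if "L > 0" "m > 0" for L m
    using fourier_inversion[OF that(1) assms(2) p assms(5,7,8), of m "\<lambda>_. 0"]
      fourier_coeff_parts[OF p assms(5) that(2), of L]
    by (simp add: return_prob_def)
  have limit_A: "(\<lambda>n. ?A (sqrt (real n)) (m n)) \<longlonglongrightarrow> ?K"
    if "(\<lambda>n. real (m n) / real n) \<longlonglongrightarrow> 1" for m
    by (rule positive_part_integral_limit[OF assms(3) pos assms(5) that])
  have id: "(\<lambda>n. real n / real n) \<longlonglongrightarrow> 1" by real_asymp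
  show ?thesis
  proof (intro conjI impI allI)
    assume "p 0 > 0"
    have "(\<lambda>n. (- 1) ^ n * ?B (sqrt (real n)) n) \<longlonglongrightarrow> 0"
      using negative_part_integral_null[OF p assms(5) \<open>p 0 > 0\<close>]
      by (subst tendsto_rabs_zero_iff[symmetric]) (simp add: abs_mult power_abs tendsto_rabs_zero)
    from tendsto_add[OF limit_A[OF id] this]
    have "(\<lambda>n. ?A (sqrt (real n)) n + (- 1) ^ n * ?B (sqrt (real n)) n) \<longlonglongrightarrow> 1 * ?K" by simp
    moreover have "eventually (\<lambda>n. ?A (sqrt (real n)) n + (- 1) ^ n * ?B (sqrt (real n)) n =
        (2 * pi * sqrt (real n)) ^ N * ?r n) sequentially"
      using eventually_gt_at_top[of 0] by eventually_elim (simp add: scaled)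
    ultimately have "(\<lambda>n. (2 * pi * sqrt (real n)) ^ N * ?r n) \<longlonglongrightarrow> 1 * ?K"
      by (rule Lim_transform_eventually)
    from asymp_equiv_from_scaled_limit[OF pos _ order_refl this]
    show "?r \<sim>[sequentially] (\<lambda>n. C_const N p / real n powr (real N / 2))" by simp
  next
    fix n :: nat assume "p 0 = 0" "odd n"
    then show "?r n = 0"
      using walk_parity[OF assms(2) p \<open>p 0 = 0\<close> assms(7,8), of n "\<lambda>_. 0"] by (simp add: return_prob_def)
  next
    assume "p 0 = 0"
    let ?E = "inf sequentially (principal {n. even n}) :: nat filter"
    \<comment> \<open>Odd return probabilities vanish, so the two parts cancel at odd exponents.\<close>
    have odd: "?A L m = ?B L m" if "odd m" "L > 0" for L m
      using scaled[OF that(2), of m] that(1)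
        walk_parity[OF assms(2) p \<open>p 0 = 0\<close> assms(7,8), of m "\<lambda>_. 0"]
      by (auto simp: return_prob_def odd_pos)
    have even_pos: "eventually (\<lambda>n. even n \<and> n > 0) ?E"
      unfolding eventually_inf_principal
      by (rule eventually_mono[OF eventually_gt_at_top[of 0]]) simp
    have limit_A': "((\<lambda>n. ?A (sqrt (real n)) (m n)) \<longlongrightarrow> ?K) ?E"
      if "(\<lambda>n. real (m n) / real n) \<longlonglongrightarrow> 1" for m
      using limit_A[OF that] by (rule tendsto_mono[OF inf_le1])
    \<comment> \<open>At the odd exponents next to \<open>n\<close> the two parts agree, and monotonicity carries the limit of the
      positive part over to the negative part at \<open>n\<close>.\<close>
    have "((\<lambda>n. ?B (sqrt (real n)) n) \<longlongrightarrow> ?K) ?E"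
    proof (rule tendsto_sandwich)
      show "((\<lambda>n. ?A (sqrt (real n)) (n + 1)) \<longlongrightarrow> ?K) ?E" by (rule limit_A') real_asymp
      show "((\<lambda>n. ?A (sqrt (real n)) (n - 1)) \<longlongrightarrow> ?K) ?E" by (rule limit_A') real_asymp
      show "eventually (\<lambda>n. ?A (sqrt (real n)) (n + 1) \<le> ?B (sqrt (real n)) n) ?E"
        using even_pos
      proof eventually_elim
        case (elim n)
        then show ?case
          using odd[of "n + 1" "sqrt (real n)"] parts_antimono(2)[OF p assms(5), of n "n + 1" "sqrt (real n)"] by simp
      qed
      show "eventually (\<lambda>n. ?B (sqrt (real n)) n \<le> ?A (sqrt (real n)) (n - 1)) ?E"
        using even_pos
      proof eventually_elim
        case (elim n)
        then show ?case
          using odd[of "n - 1" "sqrt (real n)"] parts_antimono(2)[OF p assms(5), of "n - 1" n "sqrt (real n)"] by simp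
      qed
    qed
    from tendsto_add[OF limit_A'[OF id] this]
    have "((\<lambda>n. ?A (sqrt (real n)) n + ?B (sqrt (real n)) n) \<longlongrightarrow> 2 * ?K) ?E" by simp
    moreover have "eventually (\<lambda>n. ?A (sqrt (real n)) n + ?B (sqrt (real n)) n =
        (2 * pi * sqrt (real n)) ^ N * ?r n) ?E"
      using even_pos by eventually_elim (simp add: scaled)
    ultimately have "((\<lambda>n. (2 * pi * sqrt (real n)) ^ N * ?r n) \<longlongrightarrow> 2 * ?K) ?E"
      by (rule Lim_transform_eventually)
    from asymp_equiv_from_scaled_limit[OF pos _ inf_le1 this]
    show "?r \<sim>[?E] (\<lambda>n. 2 * C_const N p / real n powr (real N / 2))" by simp
  qed
qed

end
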